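(* For each $\nu=1,2,\dots$ let $\mathbf a^{(\nu)}=(a^{(\nu)}_1,\dots,a^{(\nu)}_{m^{(\nu)}})$ be a tuple with $m^{(\nu)}\ge 2$ and all $a^{(\nu)}_j\ge 1$ integers, and suppose that $N^{(\nu)}-\max_j a^{(\nu)}_j\to\infty$ as $\nu\to\infty$, where $N^{(\nu)}=\sum_j a^{(\nu)}_j$. Let $M^{(\nu)}$ be the number of inversions of a uniformly random word with content $\mathbf a^{(\nu)}$, with mean $\mu^{(\nu)}$ and standard deviation $\sigma^{(\nu)}$. Then $$\frac{M^{(\nu)}-\mu^{(\nu)}}{\sigma^{(\nu)}}$$ converges in distribution to the standard normal distribution $\mathcal N(0,1)$ as $\nu\to\infty$.
   Context: For a tuple $(a_1,\dots,a_m)$ of positive integers, a word with content $(a_1,\dots,a_m)$ is a word $w_1\cdots w_N$, $N=a_1+\dots+a_m$, over the alphabet $\{1,\dots,m\}$ in which letter $i$ occurs exactly $a_i$ times. An inversion of $w$ is a pair $1\le i<j\le N$ with $w_i>w_j$. The random variable $M_{a_1,\dots,a_m}$ is the number of inversions of a word chosen uniformly at random among all $\binom{N}{a_1,\dots,a_m}$ words with content $(a_1,\dots,a_m)$. Its mean is $\mu=e_2(a_1,\dots,a_m)/2$ and its variance is $\sigma^2=\frac{(e_1+1)e_2-e_3}{12}$, where $e_k$ denotes the $k$-th elementary symmetric polynomial evaluated at $(a_1,\dots,a_m)$. *)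

theory Defs
  imports "HOL-Probability.Probability"
begin

text \<open>
  A tuple \<open>(a\<^sub>1, \<dots>, a\<^sub>m)\<close> is a list of naturals; list positions are counted from 0, letters from 1,
  so the multiplicity of the letter \<open>i\<close> is \<open>a ! (i - 1)\<close>.
\<close>

definition words :: "nat list \<Rightarrow> nat list set" where
  "words a = {w. length w = sum_list a \<and> set w \<subseteq> {1..length a} \<and>
                 (\<forall>i\<in>{1..length a}. count_list w i = a ! (i - 1))}"

definition inversions :: "nat list \<Rightarrow> nat" where
  "inversions w = card {(i, j). i < j \<and> j < length w \<and> w ! i > w ! j}"

lemma finite_words: "finite (words a)"
  by (rule finite_subset[OF _ finite_lists_length_eq[of "{1..length a}" "sum_list a"]])
     (auto simp: words_def)

lemma words_nonempty: "words a \<noteq> {}"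
proof (induction a rule: rev_induct)
  case Nil
  then show ?case by (auto simp: words_def)
next
  case (snoc x a)
  then obtain w where w: "w \<in> words a" by blast
  have replicate: "count_list (replicate n y) i = (if i = y then n else 0)" for n and y i :: nat
    by (induction n) auto
  have "count_list w (Suc (length a)) = 0"
    using w by (auto simp: words_def count_list_0_iff)
  moreover have "i = Suc (length a)" if "i \<le> Suc (length a)" "\<not> i \<le> length a" for i
    using that by simp
  ultimately have "w @ replicate x (Suc (length a)) \<in> words (a @ [x])"
    using w by (auto simp: words_def replicate nth_append le_Suc_eq Suc_le_eq)
  then show ?case by blast
qed

text \<open>
  The set of words is finite and nonempty, so this is a genuine uniform distribution.
\<close>

definition random_word :: "nat list \<Rightarrow> nat list pmf" where
  "random_word a = pmf_of_set (words a)"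

definition inv_mean :: "nat list \<Rightarrow> real" where
  "inv_mean a = measure_pmf.expectation (random_word a) (\<lambda>w. real (inversions w))"

definition inv_sd :: "nat list \<Rightarrow> real" where
  "inv_sd a = sqrt (measure_pmf.variance (random_word a) (\<lambda>w. real (inversions w)))"

end

theory Submission
  imports Defs
begin

text \<open>
  By MacMahon, the generating function of the inversions is the \<open>q\<close>-multinomial coefficient
  \<open>[N]! / ([a\<^sub>1]! \<dots> [a\<^sub>m]!)\<close>. At \<open>q = cis t\<close> this makes the characteristic function of the centred
  variable the quotient of the products of \<open>sinc (j t / 2)\<close> over \<open>j \<le> N\<close> and over \<open>j \<le> a\<^sub>i\<close>, all \<open>i\<close>.
  As \<open>ln (sinc x) = - x\<^sup>2 / 6 + O(x\<^sup>4)\<close>, and the factors belonging to the largest block \<open>a\<^sub>*\<close> cancel,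
  its logarithm is \<open>- \<sigma>\<^sup>2 t\<^sup>2 / 2 + O((N - a\<^sub>*) N\<^sup>4 t\<^sup>4)\<close>. Since \<open>\<sigma>\<^sup>2 \<ge> N\<^sup>2 (N - a\<^sub>*) / 36\<close>, replacing
  \<open>t\<close> by \<open>t / \<sigma>\<close> gives \<open>- t\<^sup>2 / 2 + O(t\<^sup>4 / (N - a\<^sub>*))\<close>, and Levy's continuity theorem applies.
\<close>

section \<open>Arithmetic of \<open>q\<close>-integers and \<open>q\<close>-factorials\<close>

definition q_int :: "'a::comm_semiring_1 \<Rightarrow> nat \<Rightarrow> 'a" where
  "q_int q n = (\<Sum>k<n. q ^ k)"

definition q_fact :: "'a::comm_semiring_1 \<Rightarrow> nat \<Rightarrow> 'a" where
  "q_fact q n = (\<Prod>j=1..n. q_int q j)"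

lemma q_int_0 [simp]: "q_int q 0 = 0"
  by (simp add: q_int_def)

lemma q_int_one [simp]: "q_int 1 n = of_nat n"
  by (simp add: q_int_def)

lemma q_fact_0 [simp]: "q_fact q 0 = 1"
  by (simp add: q_fact_def)

lemma q_fact_Suc: "q_fact q (Suc n) = q_int q (Suc n) * q_fact q n"
  by (simp add: q_fact_def mult.commute)

lemma q_fact_one [simp]: "q_fact 1 n = of_nat (fact n)"
  by (induction n) (simp_all add: q_fact_Suc algebra_simps)

lemma q_int_add: "q_int q (m + n) = q_int q m + q ^ m * q_int q n"
  by (induction n) (simp_all add: q_int_def power_add algebra_simps)

text \<open>The geometric sum is cut into consecutive blocks. The powers of \<open>q\<close> are the
  weights of the leading letters in \<open>inv_gf_rec\<close>, which is what closes the induction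
  for MacMahon's formula.\<close>

lemma q_int_sum:
  fixes b :: "nat \<Rightarrow> nat"
  shows "q_int q (\<Sum>j<k. b j) = (\<Sum>i<k. q ^ (\<Sum>j<i. b j) * q_int q (b i))"
  by (induction k) (simp_all add: q_int_add)

section \<open>Words and inversions under removal of the first letter\<close>

lemma length_filter_eq_sum_count_list:
  assumes "finite A"
  shows "length (filter (\<lambda>y. y \<in> A) w) = (\<Sum>y\<in>A. count_list w y)"
proof (induction w)
  case (Cons x w)
  have "(\<Sum>y\<in>A. count_list (x # w) y) = (\<Sum>y\<in>A. count_list w y + (if x = y then 1 else 0))"
    by (intro sum.cong) auto
  also have "\<dots> = (\<Sum>y\<in>A. count_list w y) + (if x \<in> A then 1 else 0)"
    using assms by (simp add: sum.distrib)
  finally show ?case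
    using Cons.IH by simp
qed simp

lemma inversions_Nil [simp]: "inversions [] = 0"
  by (simp add: inversions_def)

text \<open>Inversions are split by their first index: those with index 0 pair the head with a
  smaller letter of the tail, all others are inversions of \<open>w\<close> with both indices
  shifted by one.\<close>

lemma inversions_Cons: "inversions (x # w) = length (filter (\<lambda>y. y < x) w) + inversions w"
proof -
  let ?I = "{(i, j). i < j \<and> j < length w \<and> w ! i > w ! j}"
  let ?J = "{j. j < length w \<and> w ! j < x}"
  have fin: "finite ?I"
    by (rule finite_subset[of _ "{..<length w} \<times> {..<length w}"]) auto
  have "{(i, j). i < j \<and> j < length (x # w) \<and> (x # w) ! i > (x # w) ! j}
      = (\<lambda>j. (0, Suc j)) ` ?J \<union> map_prod Suc Suc ` ?I" (is "?S = ?T")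
  proof (intro equalityI subsetI)
    fix p assume "p \<in> ?S"
    then obtain i j where p: "p = (i, Suc j)" "i < Suc j" "j < length w" "(x # w) ! i > w ! j"
      by (cases p; case_tac b) auto
    show "p \<in> ?T"
    proof (cases i)
      case 0
      then show ?thesis using p by auto
    next
      case (Suc i')
      then have "(i', j) \<in> ?I" using p by auto
      then show ?thesis using p Suc by force
    qed
  qed auto
  moreover have "card ((\<lambda>j. (0::nat, Suc j)) ` ?J) = length (filter (\<lambda>y. y < x) w)"
    by (subst card_image) (auto simp: inj_on_def length_filter_conv_card)
  moreover have "card (map_prod Suc Suc ` ?I) = card ?I"
    by (intro card_image) (auto simp: inj_on_def)
  ultimately show ?thesis
    unfolding inversions_def using fin
    by (subst \<open>?S = ?T\<close>, subst card_Un_disjoint) auto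
qed

lemma sum_list_decrement:
  assumes "i < length a" "a ! i > (0::nat)"
  shows "Suc (sum_list (a[i := a ! i - 1])) = sum_list a"
  using assms
proof (induction a arbitrary: i)
  case (Cons x a)
  then show ?case by (cases i) auto
qed simp

lemma words_Cons_iff:
  assumes "i < length a" "a ! i > 0"
  shows "Suc i # w \<in> words a \<longleftrightarrow> w \<in> words (a[i := a ! i - 1])"
proof -
  have "(\<forall>k\<in>{1..length a}. count_list (Suc i # w) k = a ! (k - 1)) \<longleftrightarrow>
        (\<forall>k\<in>{1..length a}. count_list w k = a[i := a ! i - 1] ! (k - 1))"
    using assms by (intro ball_cong refl) (auto simp: nth_list_update)
  then show ?thesis
    using assms sum_list_decrement[OF assms] by (auto simp: words_def)
qed

lemma words_eq_UN:
  assumes "sum_list a > 0"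
  shows "words a = (\<Union>i\<in>{i. i < length a \<and> a ! i > 0}. (#) (Suc i) ` words (a[i := a ! i - 1]))"
    (is "_ = ?R")
proof (intro equalityI subsetI)
  fix w assume w: "w \<in> words a"
  then obtain x v where xv: "w = x # v"
    using assms by (cases w) (auto simp: words_def simp del: sum_list_eq_0_iff)
  define i where "i = x - 1"
  have x: "x = Suc i" "i < length a"
    using w xv by (auto simp: words_def i_def)
  have "count_list w x = a ! i"
    using w x by (auto simp: words_def)
  then have "a ! i > 0"
    using xv by auto
  with w show "w \<in> ?R"
    using x xv words_Cons_iff[of i a v] by auto
qed (auto simp: words_Cons_iff)

lemma count_smaller_letters:
  assumes "w \<in> words a" "i < length a"
  shows "length (filter (\<lambda>y. y < Suc i) w) = (\<Sum>j<i. a ! j)"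
proof -
  have "filter (\<lambda>y. y < Suc i) w = filter (\<lambda>y. y \<in> {1..i}) w"
    using assms by (intro filter_cong) (auto simp: words_def)
  also have "length \<dots> = (\<Sum>y=1..i. count_list w y)"
    by (rule length_filter_eq_sum_count_list) simp
  also have "\<dots> = (\<Sum>y=1..i. a ! (y - 1))"
    using assms by (intro sum.cong) (auto simp: words_def)
  also have "\<dots> = (\<Sum>j<i. a ! j)"
    by (rule sum.reindex_bij_witness[of _ Suc "\<lambda>y. y - 1"]) auto
  finally show ?thesis .
qed

section \<open>The generating function of inversions and MacMahon's formula\<close>

definition inv_gf :: "'a::comm_semiring_1 \<Rightarrow> nat list \<Rightarrow> 'a" where
  "inv_gf q a = (\<Sum>w\<in>words a. q ^ inversions w)"

text \<open>Removing a leading letter \<open>i + 1\<close> removes one inversion per occurrence of a smaller letter.\<close>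

lemma inv_gf_rec:
  assumes "sum_list a > 0"
  shows "inv_gf q a = (\<Sum>i\<in>{i. i < length a \<and> a ! i > 0}.
           q ^ (\<Sum>j<i. a ! j) * inv_gf q (a[i := a ! i - 1]))"
proof -
  let ?I = "{i. i < length a \<and> a ! i > 0}"
  have "inv_gf q a = (\<Sum>i\<in>?I. \<Sum>w\<in>(#) (Suc i) ` words (a[i := a ! i - 1]). q ^ inversions w)"
    unfolding inv_gf_def words_eq_UN[OF assms]
    by (rule sum.UNION_disjoint) (auto simp: finite_words)
  also have "\<dots> = (\<Sum>i\<in>?I. q ^ (\<Sum>j<i. a ! j) * inv_gf q (a[i := a ! i - 1]))"
  proof (intro sum.cong refl)
    fix i assume i: "i \<in> ?I"
    have "(\<Sum>w\<in>(#) (Suc i) ` words (a[i := a ! i - 1]). q ^ inversions w)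
        = (\<Sum>w\<in>words (a[i := a ! i - 1]). q ^ inversions (Suc i # w))"
      by (subst sum.reindex) auto
    also have "\<dots> = (\<Sum>w\<in>words (a[i := a ! i - 1]). q ^ (\<Sum>j<i. a ! j) * q ^ inversions w)"
    proof (intro sum.cong refl)
      fix w assume "w \<in> words (a[i := a ! i - 1])"
      from count_smaller_letters[OF this, of i] i
      have "length (filter (\<lambda>y. y < Suc i) w) = (\<Sum>j<i. a ! j)"
        by simp
      then show "q ^ inversions (Suc i # w) = q ^ (\<Sum>j<i. a ! j) * q ^ inversions w"
        by (simp add: inversions_Cons power_add)
    qed
    finally show "(\<Sum>w\<in>(#) (Suc i) ` words (a[i := a ! i - 1]). q ^ inversions w)
        = q ^ (\<Sum>j<i. a ! j) * inv_gf q (a[i := a ! i - 1])"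
      by (simp add: inv_gf_def sum_distrib_left)
  qed
  finally show ?thesis .
qed

lemma prod_q_fact_decrement:
  assumes "i < length a" "a ! i > 0"
  shows "(\<Prod>x\<leftarrow>a. q_fact q x) = q_int q (a ! i) * (\<Prod>x\<leftarrow>a[i := a ! i - 1]. q_fact q x)"
  using assms
proof (induction a arbitrary: i)
  case (Cons x a)
  show ?case
  proof (cases i)
    case 0
    then show ?thesis using Cons.prems q_fact_Suc[of q "x - 1"] by (simp add: mult_ac)
  next
    case (Suc k)
    then show ?thesis using Cons by (simp add: mult_ac)
  qed
qed simp

text \<open>The product form needs no division, so it can be evaluated at \<open>q = 1\<close> and
  on the unit circle, where \<open>q\<close>-factorials may vanish. In the induction step, the
  factor \<open>q_int q (a ! i)\<close> split off from the block of the leading letter joins that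
  letter's weight, and \<open>q_int_sum\<close> collects these terms into
  \<open>q_int q (Suc n)\<close>.\<close>

lemma MacMahon_inversions: "inv_gf q a * (\<Prod>x\<leftarrow>a. q_fact q x) = q_fact q (sum_list a)"
proof (induction "sum_list a" arbitrary: a)
  case 0
  then have z: "\<forall>x\<in>set a. x = 0" by simp
  then have "(\<Prod>x\<leftarrow>a. q_fact q x) = 1"
    by (induction a) auto
  moreover have "w = []" if "w \<in> words a" for w
    using that by (simp add: words_def flip: 0)
  then have "words a = {[]}"
    using words_nonempty[of a] by blast
  ultimately show ?case
    by (simp add: inv_gf_def flip: 0)
next
  case (Suc n)
  let ?I = "{i. i < length a \<and> a ! i > 0}"
  let ?P = "\<lambda>b. \<Prod>x\<leftarrow>b. q_fact q x"
  have pos: "sum_list a > 0"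
    using Suc.hyps(2) by linarith
  have "inv_gf q a * ?P a
      = (\<Sum>i\<in>?I. q ^ (\<Sum>j<i. a ! j) * q_int q (a ! i) * (inv_gf q (a[i := a ! i - 1]) * ?P (a[i := a ! i - 1])))"
    unfolding inv_gf_rec[OF pos] sum_distrib_right
  proof (intro sum.cong refl)
    fix i assume "i \<in> ?I"
    then have P: "?P a = q_int q (a ! i) * ?P (a[i := a ! i - 1])"
      by (intro prod_q_fact_decrement) auto
    show "q ^ (\<Sum>j<i. a ! j) * inv_gf q (a[i := a ! i - 1]) * ?P a
      = q ^ (\<Sum>j<i. a ! j) * q_int q (a ! i) * (inv_gf q (a[i := a ! i - 1]) * ?P (a[i := a ! i - 1]))"
      unfolding P by (simp only: mult_ac)
  qed
  also have "\<dots> = (\<Sum>i\<in>?I. q ^ (\<Sum>j<i. a ! j) * q_int q (a ! i) * q_fact q n)"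
  proof (intro sum.cong refl)
    fix i assume "i \<in> ?I"
    then have n: "sum_list (a[i := a ! i - 1]) = n"
      using sum_list_decrement[of i a] Suc.hyps(2) by simp
    show "q ^ (\<Sum>j<i. a ! j) * q_int q (a ! i) * (inv_gf q (a[i := a ! i - 1]) * ?P (a[i := a ! i - 1]))
      = q ^ (\<Sum>j<i. a ! j) * q_int q (a ! i) * q_fact q n"
      unfolding Suc.hyps(1)[OF n[symmetric]] n ..
  qed
  \<comment> \<open>Absent letters may be added to the sum because
    \<open>q_int q 0 = 0\<close>.\<close>
  also have "\<dots> = (\<Sum>i<length a. q ^ (\<Sum>j<i. a ! j) * q_int q (a ! i) * q_fact q n)"
    by (intro sum.mono_neutral_left) auto
  also have "\<dots> = q_int q (\<Sum>i<length a. a ! i) * q_fact q n"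
    by (simp add: q_int_sum sum_distrib_right)
  also have "(\<Sum>i<length a. a ! i) = Suc n"
    using Suc.hyps(2) by (simp add: sum_list_sum_nth atLeast0LessThan)
  finally show ?case
    using Suc.hyps(2) q_fact_Suc[of q n] by simp
qed

section \<open>Evaluation on the unit circle\<close>

lemma sin_half_mult_q_int_cis:
  "of_real (sin (t / 2)) * q_int (cis t) n = cis (t * (real n - 1) / 2) * of_real (sin (real n * t / 2))"
proof (induction n)
  case (Suc n)
  define u h where "u = real n * t / 2" and "h = t / 2"
  have "of_real (sin h) * q_int (cis t) (Suc n)
      = of_real (sin h) * q_int (cis t) n + of_real (sin h) * cis t ^ n"
    by (simp add: q_int_def algebra_simps)
  also have "cis t ^ n = cis u * cis u"
    by (simp add: u_def Complex.DeMoivre cis_mult mult.commute)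
  also have "of_real (sin h) * q_int (cis t) n = cis u * cis (- h) * of_real (sin u)"
    using Suc.IH by (simp add: u_def h_def cis_mult algebra_simps diff_divide_distrib)
  also have "cis u * cis (- h) * of_real (sin u) + of_real (sin h) * (cis u * cis u)
      = cis u * (cis (- h) * of_real (sin u) + of_real (sin h) * cis u)"
    by (simp add: algebra_simps)
  \<comment> \<open>The imaginary parts cancel, and the real parts are the addition formula for the
    sine.\<close>
  also have "cis (- h) * of_real (sin u) + of_real (sin h) * cis u = of_real (sin (u + h))"
    by (simp add: complex_eq_iff sin_add algebra_simps)
  finally show ?case
    by (simp add: u_def h_def algebra_simps add_divide_distrib)
qed simp

text \<open>With \<open>sinc\<close> in place of \<open>sin\<close> the identity stays informative
  at \<open>t = 0\<close>, where both sides are \<open>n\<close>.\<close>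

lemma sinc_mult_q_int_cis:
  "q_int (cis t) n * of_real (sinc (t / 2))
     = cis (t * (real n - 1) / 2) * of_real (real n * sinc (real n * t / 2))"
  using sin_half_mult_q_int_cis[of t n]
  by (cases "t = 0"; cases "n = 0") (auto simp: field_simps)

definition sinc_prod :: "nat \<Rightarrow> real \<Rightarrow> real" where
  "sinc_prod n t = (\<Prod>j=1..n. sinc (real j * t / 2))"

text \<open>The mean number of inversions of a random permutation of \<open>n\<close> letters.\<close>

definition half_pairs :: "nat \<Rightarrow> real" where
  "half_pairs n = real n * (real n - 1) / 4"

text \<open>The phases \<open>t * (j - 1) / 2\<close> add up to \<open>t * half_pairs n\<close>. The
  power of \<open>sinc (t / 2)\<close> depends on \<open>n\<close> alone, so it is the same for the
  whole word as for all blocks together.\<close>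

lemma q_fact_cis:
  "q_fact (cis t) n * of_real (sinc (t / 2)) ^ n
     = cis (t * half_pairs n) * of_real (fact n * sinc_prod n t)"
proof (induction n)
  case 0
  then show ?case by (simp add: sinc_prod_def half_pairs_def)
next
  case (Suc n)
  have "q_fact (cis t) (Suc n) * of_real (sinc (t / 2)) ^ Suc n
      = (q_int (cis t) (Suc n) * of_real (sinc (t / 2))) * (q_fact (cis t) n * of_real (sinc (t / 2)) ^ n)"
    by (simp add: q_fact_Suc mult_ac)
  also have "\<dots> = cis (t * (real (Suc n) - 1) / 2) * cis (t * half_pairs n) *
      of_real (real (Suc n) * sinc (real (Suc n) * t / 2) * (fact n * sinc_prod n t))"
    unfolding Suc.IH sinc_mult_q_int_cis by (simp only: of_real_mult mult_ac)
  also have "cis (t * (real (Suc n) - 1) / 2) * cis (t * half_pairs n) = cis (t * half_pairs (Suc n))"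
    unfolding cis_mult by (rule arg_cong[of _ _ cis]) (simp add: half_pairs_def field_simps)
  also have "real (Suc n) * sinc (real (Suc n) * t / 2) * (fact n * sinc_prod n t)
      = fact (Suc n) * sinc_prod (Suc n) t"
    by (simp add: sinc_prod_def mult_ac)
  finally show ?case .
qed

lemma prod_list_q_fact_cis:
  "(\<Prod>x\<leftarrow>a. q_fact (cis t) x) * of_real (sinc (t / 2)) ^ sum_list a
     = cis (t * (\<Sum>x\<leftarrow>a. half_pairs x)) * of_real ((\<Prod>x\<leftarrow>a. fact x) * (\<Prod>x\<leftarrow>a. sinc_prod x t))"
proof (induction a)
  case (Cons x a)
  let ?s = "of_real (sinc (t / 2)) :: complex"
  have "(\<Prod>y\<leftarrow>x # a. q_fact (cis t) y) * ?s ^ sum_list (x # a)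
     = (q_fact (cis t) x * ?s ^ x) * ((\<Prod>y\<leftarrow>a. q_fact (cis t) y) * ?s ^ sum_list a)"
    by (simp only: list.map prod_list.Cons sum_list.Cons power_add mult_ac)
  also have "\<dots> = (cis (t * half_pairs x) * cis (t * (\<Sum>x\<leftarrow>a. half_pairs x))) *
      of_real (fact x * sinc_prod x t * ((\<Prod>x\<leftarrow>a. fact x) * (\<Prod>x\<leftarrow>a. sinc_prod x t)))"
    unfolding Cons.IH q_fact_cis by (simp only: of_real_mult mult_ac)
  finally show ?case
    by (simp add: cis_mult algebra_simps)
qed simp

text \<open>This is \<open>e_2 / 2\<close> in the entries of \<open>a\<close>, arising here as the
  phase left over in MacMahon's formula. It is identified with the mean in
  \<open>inv_mean_eq\<close>.\<close>

definition inv_center :: "nat list \<Rightarrow> real" where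
  "inv_center a = half_pairs (sum_list a) - (\<Sum>x\<leftarrow>a. half_pairs x)"

definition inv_centered :: "nat list \<Rightarrow> nat list \<Rightarrow> real" where
  "inv_centered a w = real (inversions w) - inv_center a"

text \<open>MacMahon's formula at \<open>q = 1\<close> is the multinomial count.\<close>

lemma card_words_mult: "real (card (words a)) * (\<Prod>x\<leftarrow>a. fact x) = fact (sum_list a)"
  using MacMahon_inversions[of "1 :: real" a] by (simp add: inv_gf_def)

text \<open>Centring removes exactly the remaining phase, so the right-hand side is real. The
  \<open>sinc\<close> products of the blocks stay on the left because they may vanish for some
  \<open>t\<close>.\<close>

lemma sum_cis_inv_centered:
  "(\<Sum>w\<in>words a. cis (t * inv_centered a w)) * of_real (\<Prod>x\<leftarrow>a. sinc_prod x t)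
     = of_real (card (words a) * sinc_prod (sum_list a) t)"
proof -
  let ?s = "of_real (sinc (t / 2)) :: complex"
  let ?N = "sum_list a"
  let ?F = "(\<Prod>x\<leftarrow>a. fact x) :: real"
  let ?P = "(\<Prod>x\<leftarrow>a. sinc_prod x t)"
  let ?E = "\<Sum>x\<leftarrow>a. half_pairs x"
  let ?\<Phi> = "\<Sum>w\<in>words a. cis (t * inv_centered a w)"
  have \<Phi>: "inv_gf (cis t) a = cis (t * inv_center a) * ?\<Phi>"
    by (simp add: inv_gf_def inv_centered_def sum_distrib_left cis_mult Complex.DeMoivre algebra_simps)
  have F: "?F \<noteq> 0"
    using card_words_mult[of a] by auto
  have "inv_gf (cis t) a * ((\<Prod>x\<leftarrow>a. q_fact (cis t) x) * ?s ^ ?N) = q_fact (cis t) ?N * ?s ^ ?N"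
    by (simp only: MacMahon_inversions flip: mult.assoc)
  then have "cis (t * inv_center a) * ?\<Phi> * (cis (t * ?E) * of_real (?F * ?P))
      = cis (t * half_pairs ?N) * of_real (fact ?N * sinc_prod ?N t)"
    unfolding \<Phi> prod_list_q_fact_cis q_fact_cis .
  also have "cis (t * half_pairs ?N) = cis (t * inv_center a) * cis (t * ?E)"
    by (simp add: cis_mult inv_center_def algebra_simps)
  finally have "?\<Phi> * of_real (?F * ?P) = of_real (fact ?N * sinc_prod ?N t)"
    by (simp add: mult_ac)
  also have "fact ?N = real (card (words a)) * ?F"
    by (rule card_words_mult[symmetric])
  finally show ?thesis
    using F by simp
qed

section \<open>Taylor estimates for the logarithm of \<open>sinc\<close>\<close>

lemma sinc_bound:
  assumes "\<bar>x\<bar> \<le> 1"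
  shows "\<bar>sinc x - (1 - x\<^sup>2 / 6)\<bar> \<le> x ^ 4 / 120"
proof (cases "x = 0")
  case False
  have "\<bar>sin x - (x - x ^ 3 / 6)\<bar> \<le> \<bar>x\<bar> ^ 5 / 120"
  proof -
    \<comment> \<open>The quartic coefficient of the sine is 0, so the cubic polynomial already has
      a remainder of order 5.\<close>
    have "(\<Sum>m<5. sin_coeff m * x ^ m) = x - x ^ 3 / 6"
      by (simp add: sin_coeff_def lessThan_nat_numeral lessThan_Suc fact_numeral)
    then show ?thesis
      using Maclaurin_sin_bound[of x 5] by (simp add: fact_numeral)
  qed
  moreover have "sin x - (x - x ^ 3 / 6) = x * (sinc x - (1 - x\<^sup>2 / 6))"
    using False by (simp add: field_simps power2_eq_square power3_eq_cube)
  moreover have "\<bar>x\<bar> ^ 5 / 120 = \<bar>x\<bar> * (x ^ 4 / 120)"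
    by (simp add: eval_nat_numeral abs_mult)
  ultimately show ?thesis
    using False mult_le_cancel_left_pos[of "\<bar>x\<bar>" "\<bar>sinc x - (1 - x\<^sup>2 / 6)\<bar>" "x ^ 4 / 120"]
    by (simp only: abs_mult zero_less_abs_iff not_False_eq_True simp_thms)
qed simp

text \<open>For \<open>y = sinc x - 1\<close>, \<open>ln (1 + y)\<close> differs from
  \<open>y\<close> by at most \<open>2 * y^2\<close>, and \<open>y^2\<close> is at most
  \<open>x^4 / 16\<close>. The total constant \<open>1/120 + 1/8\<close> is rounded up to 1.\<close>

lemma ln_sinc_bound:
  assumes "\<bar>x\<bar> \<le> 1"
  shows "sinc x > 0" "\<bar>ln (sinc x) + x\<^sup>2 / 6\<bar> \<le> x ^ 4"
proof -
  define y where "y = sinc x - 1"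
  have x2: "x\<^sup>2 \<le> 1" "0 \<le> x\<^sup>2"
    using assms by (auto simp: abs_square_le_1)
  have x4: "x ^ 4 = x\<^sup>2 * x\<^sup>2"
    by (simp add: eval_nat_numeral)
  then have x42: "x ^ 4 \<le> x\<^sup>2"
    using x2 mult_left_le[of "x\<^sup>2" "x\<^sup>2"] by simp
  have y1: "\<bar>y + x\<^sup>2 / 6\<bar> \<le> x ^ 4 / 120"
    using sinc_bound[OF assms] unfolding y_def by argo
  \<comment> \<open>Here \<open>1/6 + 1/120 < 1/4\<close>.\<close>
  have y2: "\<bar>y\<bar> \<le> x\<^sup>2 / 4"
    using y1 x42 x2 by linarith
  then have y3: "\<bar>y\<bar> \<le> 1 / 2"
    using x2 by linarith
  then show "sinc x > 0"
    unfolding y_def by argo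
  have "y\<^sup>2 \<le> (x\<^sup>2 / 4)\<^sup>2"
    using y2 x2 by (intro abs_le_square_iff[THEN iffD1]) auto
  then have "y\<^sup>2 \<le> x ^ 4 / 16"
    by (simp add: x4 power2_eq_square)
  moreover have "\<bar>ln (sinc x) - y\<bar> \<le> 2 * y\<^sup>2"
    using abs_ln_one_plus_x_minus_x_bound[OF y3] by (simp add: y_def)
  moreover have "0 \<le> x ^ 4"
    by simp
  ultimately show "\<bar>ln (sinc x) + x\<^sup>2 / 6\<bar> \<le> x ^ 4"
    using y1 unfolding abs_le_iff by argo
qed

definition log_sinc :: "nat \<Rightarrow> real \<Rightarrow> real" where
  "log_sinc n t = (\<Sum>j=1..n. ln (sinc (real j * t / 2)))"

definition sum_squares :: "nat \<Rightarrow> real" where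
  "sum_squares n = (\<Sum>j=1..n. (real j)\<^sup>2)"

text \<open>The remainder after the quadratic terms, as the sum of \<open>(j * t / 2)^2 / 6\<close>
  over \<open>j\<close> is \<open>sum_squares n * t^2 / 24\<close>.\<close>

definition log_sinc_error :: "nat \<Rightarrow> real \<Rightarrow> real" where
  "log_sinc_error n t = log_sinc n t + sum_squares n * t\<^sup>2 / 24"

lemma half_arg_le:
  assumes "real N * \<bar>t\<bar> \<le> 1" "j \<le> N"
  shows "\<bar>real j * t / 2\<bar> \<le> 1"
proof -
  have "real j * \<bar>t\<bar> \<le> real N * \<bar>t\<bar>"
    using assms by (intro mult_right_mono) auto
  then show ?thesis
    using assms by (simp add: abs_mult)
qed

lemma sinc_prod_eq_exp:
  assumes "real N * \<bar>t\<bar> \<le> 1" "n \<le> N"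
  shows "sinc_prod n t = exp (log_sinc n t)"
  unfolding sinc_prod_def log_sinc_def exp_sum[OF finite_atLeastAtMost]
  using assms by (intro prod.cong refl exp_ln[symmetric] ln_sinc_bound half_arg_le[of N]) auto

text \<open>The terms with \<open>j \<le> m\<close> cancel. Each of the other \<open>n - m\<close>
  terms is at most \<open>(j * t / 2)^4\<close>. The case \<open>m = 0\<close> bounds the error of a
  single block.\<close>

lemma log_sinc_error_diff:
  assumes "real N * \<bar>t\<bar> \<le> 1" "m \<le> n" "n \<le> N"
  shows "\<bar>log_sinc_error n t - log_sinc_error m t\<bar> \<le> real (n - m) * ((real N * t) ^ 4 / 16)"
proof -
  let ?e = "\<lambda>j. ln (sinc (real j * t / 2)) + (real j * t / 2)\<^sup>2 / 6"
  have e: "log_sinc_error k t = sum ?e {1..k}" for k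
    by (simp add: log_sinc_error_def log_sinc_def sum_squares_def sum.distrib sum_distrib_right
        sum_divide_distrib power_mult_distrib power_divide)
  have "{1..n} = {1..m} \<union> {m<..n}"
    using assms by auto
  then have "log_sinc_error n t - log_sinc_error m t = sum ?e {m<..n}"
    unfolding e by (subst \<open>{1..n} = _\<close>, subst sum.union_disjoint) auto
  also have "\<bar>\<dots>\<bar> \<le> (\<Sum>j\<in>{m<..n}. (real N * t) ^ 4 / 16)"
  proof (rule order_trans[OF sum_abs sum_mono])
    fix j assume j: "j \<in> {m<..n}"
    have "\<bar>?e j\<bar> \<le> (real j * t / 2) ^ 4"
      using j assms by (intro ln_sinc_bound half_arg_le[of N]) auto
    also have "\<dots> = (real j * \<bar>t\<bar>) ^ 4 / 16"
      by (simp add: power_divide power_mult_distrib)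
    also have "\<dots> \<le> (real N * \<bar>t\<bar>) ^ 4 / 16"
      using j assms by (intro divide_right_mono power_mono mult_right_mono) auto
    finally show "\<bar>?e j\<bar> \<le> (real N * t) ^ 4 / 16"
      by (simp add: power_mult_distrib)
  qed
  finally show ?thesis by simp
qed

section \<open>The logarithm of the characteristic function and the size of the variance\<close>

text \<open>In elementary symmetric polynomials this is \<open>((e_1 + 1) * e_2 - e_3) / 12\<close>.
  It is shown to be the variance in \<open>sum_inv_centered_square\<close>.\<close>

definition inv_var :: "nat list \<Rightarrow> real" where
  "inv_var a = (sum_squares (sum_list a) - (\<Sum>x\<leftarrow>a. sum_squares x)) / 12"

definition log_char :: "nat list \<Rightarrow> real \<Rightarrow> real" where
  "log_char a t = log_sinc (sum_list a) t - (\<Sum>x\<leftarrow>a. log_sinc x t)"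

text \<open>The hypothesis keeps all arguments of \<open>sinc\<close> in the range where it is
  positive, so the block products can be divided out and logarithms taken.\<close>

lemma sum_cis_eq_exp_log_char:
  assumes "real (sum_list a) * \<bar>t\<bar> \<le> 1"
  shows "(\<Sum>w\<in>words a. cis (t * inv_centered a w)) = of_real (card (words a) * exp (log_char a t))"
proof -
  have "(\<Prod>x\<leftarrow>a. sinc_prod x t) = (\<Prod>x\<leftarrow>a. exp (log_sinc x t))"
    using assms
    by (intro arg_cong[of _ _ prod_list] map_cong refl sinc_prod_eq_exp) (auto intro: member_le_sum_list)
  also have "(\<Prod>x\<leftarrow>b. exp (log_sinc x t)) = exp (\<Sum>x\<leftarrow>b. log_sinc x t)" for b
    by (induction b) (auto simp: exp_add)
  finally have P: "(\<Prod>x\<leftarrow>a. sinc_prod x t) = exp (\<Sum>x\<leftarrow>a. log_sinc x t)" .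
  show ?thesis
    using sum_cis_inv_centered[of t a] assms
    by (simp add: P sinc_prod_eq_exp[of "sum_list a"] log_char_def exp_diff field_simps)
qed

lemma sum_list_real_mult: "(\<Sum>x\<leftarrow>b. real x * c) = real (sum_list b) * (c :: real)"
  by (induction b) (simp_all add: algebra_simps)

text \<open>
  The factors with \<open>j \<le> Max (set a)\<close> in the numerator cancel against those of a largest block,
  so that only \<open>2 * (sum_list a - Max (set a))\<close> factors contribute to the error.
\<close>

lemma log_char_bound:
  assumes "real (sum_list a) * \<bar>t\<bar> \<le> 1" "a \<noteq> []"
  shows "\<bar>log_char a t + inv_var a * t\<^sup>2 / 2\<bar>
           \<le> real (sum_list a - Max (set a)) * ((real (sum_list a) * t) ^ 4 / 8)"
proof -
  let ?N = "sum_list a" and ?M = "Max (set a)"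
  let ?K = "(real ?N * t) ^ 4 / 16"
  let ?b = "remove1 ?M a"
  have M: "?M \<in> set a"
    using assms by simp
  then have MN: "?M \<le> ?N"
    by (intro member_le_sum_list) auto
  have sb: "sum_list ?b = ?N - ?M"
    using sum_list_map_remove1[OF M, of "\<lambda>x. x"] by simp
  have "(\<Sum>x\<leftarrow>c. log_sinc_error x t) = (\<Sum>x\<leftarrow>c. log_sinc x t) + (\<Sum>x\<leftarrow>c. sum_squares x) * t\<^sup>2 / 24" for c
    by (induction c) (simp_all add: log_sinc_error_def algebra_simps add_divide_distrib)
  then have "log_char a t + inv_var a * t\<^sup>2 / 2 = log_sinc_error ?N t - (\<Sum>x\<leftarrow>a. log_sinc_error x t)"
    by (simp add: log_char_def inv_var_def log_sinc_error_def field_simps)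
  also have "(\<Sum>x\<leftarrow>a. log_sinc_error x t) = log_sinc_error ?M t + (\<Sum>x\<leftarrow>?b. log_sinc_error x t)"
    by (rule sum_list_map_remove1[OF M])
  finally have eq: "log_char a t + inv_var a * t\<^sup>2 / 2
      = (log_sinc_error ?N t - log_sinc_error ?M t) - (\<Sum>x\<leftarrow>?b. log_sinc_error x t)"
    by simp
  have "\<bar>\<Sum>x\<leftarrow>?b. log_sinc_error x t\<bar> \<le> (\<Sum>x\<leftarrow>?b. \<bar>log_sinc_error x t\<bar>)"
    by (rule sum_list_abs[of "map (\<lambda>x. log_sinc_error x t) ?b", unfolded map_map o_def])
  also have "\<dots> \<le> (\<Sum>x\<leftarrow>?b. real x * ?K)"
  proof (rule sum_list_mono)
    fix x assume "x \<in> set ?b"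
    then have "x \<le> ?N"
      using set_remove1_subset[of ?M a] by (intro member_le_sum_list) auto
    then show "\<bar>log_sinc_error x t\<bar> \<le> real x * ?K"
      using log_sinc_error_diff[OF assms(1), of 0 x]
      by (simp add: log_sinc_error_def[of 0] log_sinc_def[of 0] sum_squares_def[of 0])
  qed
  also have "\<dots> = real (sum_list ?b) * ?K"
    by (rule sum_list_real_mult)
  finally have "\<bar>\<Sum>x\<leftarrow>?b. log_sinc_error x t\<bar> \<le> real (?N - ?M) * ?K"
    by (simp add: sb)
  with log_sinc_error_diff[OF assms(1) MN order_refl] show ?thesis
    unfolding eq by argo
qed

lemma sum_squares_eq: "sum_squares n = real n * (real n + 1) * (2 * real n + 1) / 6"
  by (induction n) (simp_all add: sum_squares_def field_simps power2_eq_square)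

text \<open>A block of size \<open>x\<close> contributes \<open>(x + 1) * (2 * x + 1) / 6\<close>
  per letter, which is at most the rate \<open>?c\<close> of a largest block. The difference then
  contains the factor \<open>?N - ?M\<close>. Keeping only \<open>2 * ?N\<close> of the last factor
  gives \<open>1/3\<close>, and division by 12 gives \<open>1/36\<close>.\<close>

lemma inv_var_lower_bound:
  assumes "a \<noteq> []"
  shows "inv_var a \<ge> (real (sum_list a))\<^sup>2 * (real (sum_list a) - real (Max (set a))) / 36"
proof -
  let ?N = "real (sum_list a)" and ?M = "real (Max (set a))"
  let ?c = "(?M + 1) * (2 * ?M + 1) / 6"
  have MN: "?M \<le> ?N"
    using assms by (simp add: member_le_sum_list)
  have "(\<Sum>x\<leftarrow>a. sum_squares x) \<le> (\<Sum>x\<leftarrow>a. real x * ?c)"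
  proof (rule sum_list_mono)
    fix x assume "x \<in> set a"
    then have x: "real x \<le> ?M" by simp
    then have "real x * ((real x + 1) * (2 * real x + 1)) \<le> real x * ((?M + 1) * (2 * ?M + 1))"
      by (intro mult_left_mono mult_mono) auto
    then show "sum_squares x \<le> real x * ?c"
      unfolding sum_squares_eq by argo
  qed
  also have "\<dots> = ?N * ?c"
    by (rule sum_list_real_mult)
  finally have "12 * inv_var a \<ge> sum_squares (sum_list a) - ?N * ?c"
    by (simp add: inv_var_def)
  also have "sum_squares (sum_list a) - ?N * ?c = ?N * (?N - ?M) * (2 * ?N + (2 * ?M + 3)) / 6"
    by (simp add: sum_squares_eq field_simps)
  also have "\<dots> \<ge> ?N * (?N - ?M) * (2 * ?N) / 6"
    using MN by (intro divide_right_mono mult_left_mono) auto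
  finally show ?thesis
    by (simp add: power2_eq_square algebra_simps)
qed

section \<open>Mean and variance\<close>

lemma sum_cos_sin_inv_centered:
  assumes "real (sum_list a) * \<bar>t\<bar> \<le> 1"
  shows "(\<Sum>w\<in>words a. cos (t * inv_centered a w)) = card (words a) * exp (log_char a t)"
    and "(\<Sum>w\<in>words a. sin (t * inv_centered a w)) = 0"
  using arg_cong[OF sum_cis_eq_exp_log_char[OF assms], of Re]
    arg_cong[OF sum_cis_eq_exp_log_char[OF assms], of Im]
  by (simp_all add: Re_sum Im_sum)

lemma eventually_small_arg: "\<forall>\<^sub>F t in nhds 0. real N * \<bar>t\<bar> \<le> 1"
proof -
  have "((\<lambda>t::real. real N * \<bar>t\<bar>) \<longlongrightarrow> real N * \<bar>0\<bar>) (nhds 0)"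
    by (intro tendsto_intros filterlim_ident)
  then have "\<forall>\<^sub>F t in nhds 0. real N * \<bar>t\<bar> < 1"
    by (rule order_tendstoD) simp
  then show ?thesis
    by eventually_elim simp
qed

text \<open>
  The first two moments are read off from the behaviour of the characteristic function at 0:
  its imaginary part vanishes there, and its real part is \<open>exp (log_char a t)\<close>.
\<close>

lemma sum_inv_centered: "(\<Sum>w\<in>words a. inv_centered a w) = 0"
proof -
  let ?f = "\<lambda>t. \<Sum>w\<in>words a. sin (t * inv_centered a w)"
  have "(?f has_real_derivative (\<Sum>w\<in>words a. inv_centered a w)) (at 0)"
    by (auto intro!: derivative_eq_intros)
  moreover have "\<forall>\<^sub>F t in nhds 0. ?f t = 0"
    using eventually_small_arg[of "sum_list a"] by eventually_elim (rule sum_cos_sin_inv_centered)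
  then have "(?f has_real_derivative 0) (at 0)"
    by (subst DERIV_cong_ev[OF refl _ refl]) auto
  ultimately show ?thesis
    by (rule DERIV_unique)
qed

text \<open>Dividing \<open>log_char_bound\<close> by \<open>t^2\<close> leaves an error of order
  \<open>t^2\<close>.\<close>

lemma tendsto_log_char:
  assumes "a \<noteq> []"
  shows "((\<lambda>t. log_char a t / t\<^sup>2) \<longlongrightarrow> - inv_var a / 2) (at 0)"
proof -
  define K where "K = real (sum_list a - Max (set a)) * (real (sum_list a) ^ 4 / 8)"
  have "\<forall>\<^sub>F t in at 0. norm (log_char a t / t\<^sup>2 - (- inv_var a / 2)) \<le> K * t\<^sup>2"
    using eventually_nhds_conv_at[THEN iffD1, OF eventually_small_arg[of "sum_list a"], THEN conjunct1]
      eventually_neq_at_within[of 0]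
  proof eventually_elim
    case (elim t)
    have "norm (log_char a t / t\<^sup>2 - (- inv_var a / 2)) = \<bar>log_char a t + inv_var a * t\<^sup>2 / 2\<bar> / t\<^sup>2"
      using elim by (simp add: field_simps flip: abs_div_pos)
    also have "\<dots> \<le> (K * t ^ 4) / t\<^sup>2"
      using log_char_bound[OF elim(1) assms]
      by (intro divide_right_mono) (simp_all add: K_def power_mult_distrib)
    also have "\<dots> = K * t\<^sup>2"
      using elim by (simp add: eval_nat_numeral)
    finally show ?case .
  qed
  moreover have "((\<lambda>t. K * t\<^sup>2) \<longlongrightarrow> 0) (at 0)"
    using tendsto_mult_left[OF tendsto_power[OF tendsto_ident_at, of 2], of K 0 UNIV] by simp
  ultimately have "((\<lambda>t. log_char a t / t\<^sup>2 - (- inv_var a / 2)) \<longlongrightarrow> 0) (at 0)"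
    by (rule Lim_null_comparison)
  then show ?thesis
    by (rule LIM_zero_cancel)
qed

text \<open>The half-angle formula reduces this to the derivative of the sine at 0.\<close>

lemma tendsto_cos_minus_one: "((\<lambda>t. (cos (t * x) - 1) / t\<^sup>2) \<longlongrightarrow> - x\<^sup>2 / 2) (at (0::real))"
proof -
  have "((\<lambda>t. sin (t * (x / 2))) has_real_derivative x / 2) (at 0)"
    by (auto intro!: derivative_eq_intros)
  then have "((\<lambda>t. sin (t * (x / 2)) / t) \<longlongrightarrow> x / 2) (at 0)"
    by (simp add: has_field_derivative_iff)
  then have "((\<lambda>t. -2 * (sin (t * (x / 2)) / t)\<^sup>2) \<longlongrightarrow> -2 * (x / 2)\<^sup>2) (at 0)"
    by (intro tendsto_mult tendsto_power tendsto_const)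
  moreover have "-2 * (sin (t * (x / 2)) / t)\<^sup>2 = (cos (t * x) - 1) / t\<^sup>2" for t
    using cos_double_sin[of "t * (x / 2)"] by (simp add: power_divide)
  ultimately show ?thesis
    by (simp add: power_divide)
qed

text \<open>The quotient \<open>?f\<close> has two limits at 0: termwise, minus half the sum of
  squares, and by the closed form \<open>exp (log_char a t)\<close>, minus half of
  \<open>card (words a) * inv_var a\<close>.\<close>

lemma sum_inv_centered_square:
  assumes "a \<noteq> []"
  shows "(\<Sum>w\<in>words a. (inv_centered a w)\<^sup>2) = card (words a) * inv_var a"
proof -
  let ?c = "real (card (words a))"
  let ?f = "\<lambda>t. \<Sum>w\<in>words a. (cos (t * inv_centered a w) - 1) / t\<^sup>2"
  have lhs: "(?f \<longlongrightarrow> (\<Sum>w\<in>words a. - (inv_centered a w)\<^sup>2 / 2)) (at 0)"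
    by (intro tendsto_sum tendsto_cos_minus_one)
  \<comment> \<open>Caratheodory's form of the derivative: \<open>g\<close> extends
    \<open>(exp z - 1) / z\<close> continuously to 0, so \<open>log_char a t = 0\<close> needs no
    separate case.\<close>
  obtain g where g: "\<And>z::real. exp z - 1 = g z * z" "isCont g 0" "g 0 = 1"
    using DERIV_exp[of "0::real"] unfolding CARAT_DERIV by auto
  have small: "((\<lambda>t. log_char a t / t\<^sup>2 * t\<^sup>2) \<longlongrightarrow> - inv_var a / 2 * 0\<^sup>2) (at 0)"
    by (intro tendsto_intros tendsto_log_char assms)
  have "((\<lambda>t. g (log_char a t / t\<^sup>2 * t\<^sup>2)) \<longlongrightarrow> g 0) (at 0)"
    using g(2) small by (intro isCont_tendsto_compose[of 0 g]) auto
  then have "((\<lambda>t. ?c * (g (log_char a t / t\<^sup>2 * t\<^sup>2) * (log_char a t / t\<^sup>2))) \<longlongrightarrow> ?c * (1 * (- inv_var a / 2))) (at 0)"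
    unfolding g(3) by (intro tendsto_intros tendsto_log_char assms)
  moreover have "\<forall>\<^sub>F t in at 0. ?c * (g (log_char a t / t\<^sup>2 * t\<^sup>2) * (log_char a t / t\<^sup>2)) = ?f t"
    using eventually_nhds_conv_at[THEN iffD1, OF eventually_small_arg[of "sum_list a"], THEN conjunct1]
      eventually_neq_at_within[of 0]
  proof eventually_elim
    case (elim t)
    have "?f t = ((\<Sum>w\<in>words a. cos (t * inv_centered a w)) - ?c) / t\<^sup>2"
      by (simp add: sum_subtractf flip: sum_divide_distrib)
    also have "\<dots> = ?c * (exp (log_char a t) - 1) / t\<^sup>2"
      unfolding sum_cos_sin_inv_centered(1)[OF elim(1)] by (simp add: algebra_simps)
    finally show ?case
      using elim g(1)[of "log_char a t"] by simp
  qed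
  ultimately have rhs: "(?f \<longlongrightarrow> ?c * (1 * (- inv_var a / 2))) (at 0)"
    by (rule Lim_transform_eventually)
  have "(\<Sum>w\<in>words a. - (inv_centered a w)\<^sup>2 / 2) = ?c * (1 * (- inv_var a / 2))"
    by (rule tendsto_unique[OF _ lhs rhs]) simp
  then show ?thesis
    by (simp add: sum_negf flip: sum_divide_distrib)
qed

lemma card_words_pos: "card (words a) > 0"
  using words_nonempty finite_words by (simp add: card_gt_0_iff)

lemma inv_mean_eq: "inv_mean a = inv_center a"
proof -
  have "(\<Sum>w\<in>words a. real (inversions w)) = card (words a) * inv_center a"
    using sum_inv_centered[of a] by (simp add: inv_centered_def sum_subtractf)
  then show ?thesis
    using card_words_pos[of a]
    by (simp add: inv_mean_def random_word_def integral_pmf_of_set[OF words_nonempty finite_words])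
qed

lemma inv_sd_eq:
  assumes "a \<noteq> []"
  shows "inv_sd a = sqrt (inv_var a)"
proof -
  have "inv_sd a = sqrt (measure_pmf.expectation (random_word a) (\<lambda>w. (inv_centered a w)\<^sup>2))"
    unfolding inv_sd_def inv_centered_def by (simp only: inv_mean_eq flip: inv_mean_def)
  then show ?thesis
    using sum_inv_centered_square[OF assms] card_words_pos[of a]
    by (simp add: random_word_def integral_pmf_of_set[OF words_nonempty finite_words])
qed

section \<open>Standardization and convergence in distribution\<close>

lemma char_standardized_inversions:
  assumes "real (sum_list a) * \<bar>t / inv_sd a\<bar> \<le> 1"
  shows "char (distr (measure_pmf (random_word a)) borel (\<lambda>w. (real (inversions w) - inv_mean a) / inv_sd a)) t
    = of_real (exp (log_char a (t / inv_sd a)))"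
proof -
  have "char (distr (measure_pmf (random_word a)) borel (\<lambda>w. (real (inversions w) - inv_mean a) / inv_sd a)) t
     = (CLINT w|measure_pmf (random_word a). cis (t / inv_sd a * inv_centered a w))"
    unfolding char_def by (subst integral_distr) (simp_all add: inv_centered_def inv_mean_eq cis_conv_exp)
  also have "\<dots> = (\<Sum>w\<in>words a. pmf (random_word a) w *\<^sub>R cis (t / inv_sd a * inv_centered a w))"
    by (intro integral_measure_pmf finite_words)
      (simp add: random_word_def set_pmf_of_set[OF words_nonempty finite_words])
  also have "\<dots> = (\<Sum>w\<in>words a. cis (t / inv_sd a * inv_centered a w)) / card (words a)"
    unfolding sum_divide_distrib
    by (intro sum.cong refl)
      (simp add: random_word_def pmf_of_set[OF words_nonempty finite_words] scaleR_conv_of_real)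
  also have "\<dots> = of_real (exp (log_char a (t / inv_sd a)))"
    unfolding sum_cis_eq_exp_log_char[OF assms] using card_words_pos[of a] by simp
  finally show ?thesis .
qed

text \<open>Let \<open>d\<close> be the length minus the largest multiplicity. By
  \<open>inv_var_lower_bound\<close> the squared argument \<open>y\<close> is at most
  \<open>36 * t^2 / d\<close>. The hypothesis on \<open>t\<close> makes this at most 1, as
  \<open>log_char_bound\<close> requires, and the constant is \<open>162 = 36^2 / 8\<close>.\<close>

lemma log_char_standardized:
  assumes "a \<noteq> []" "real (sum_list a) > real (Max (set a))"
    and t: "36 * t\<^sup>2 \<le> real (sum_list a) - real (Max (set a))"
  shows "real (sum_list a) * \<bar>t / inv_sd a\<bar> \<le> 1"
    and "\<bar>log_char a (t / inv_sd a) + t\<^sup>2 / 2\<bar> \<le> 162 * t ^ 4 / (real (sum_list a) - real (Max (set a)))"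
proof -
  define N where "N = real (sum_list a)"
  define d where "d = N - real (Max (set a))"
  define y where "y = (N * (t / inv_sd a))\<^sup>2"
  have d: "d > 0" and N: "N > 0"
    using assms(2) of_nat_0_le_iff[of "Max (set a)", where 'a = real] unfolding d_def N_def by linarith+
  have v: "inv_var a \<ge> N\<^sup>2 * d / 36"
    using inv_var_lower_bound[OF assms(1)] by (simp add: d_def N_def)
  then have vpos: "inv_var a > 0"
    using d N by (smt (verit) divide_pos_pos mult_pos_pos zero_less_power)
  have sd: "(inv_sd a)\<^sup>2 = inv_var a"
    using vpos by (simp add: inv_sd_eq[OF assms(1)])
  have y: "y = N\<^sup>2 * t\<^sup>2 / inv_var a"
    by (simp add: y_def power_mult_distrib power_divide sd)
  also have "\<dots> \<le> N\<^sup>2 * t\<^sup>2 / (N\<^sup>2 * d / 36)"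
    using v d N vpos
    by (intro divide_left_mono mult_pos_pos divide_pos_pos) auto
  also have "\<dots> = 36 * t\<^sup>2 / d"
    using d N by (simp add: field_simps)
  finally have yd: "y \<le> 36 * t\<^sup>2 / d" .
  also have "\<dots> \<le> 1"
    using t d by (simp add: d_def N_def)
  finally have "\<bar>N * (t / inv_sd a)\<bar> \<le> 1"
    unfolding y_def by (simp add: abs_square_le_1)
  then show small: "real (sum_list a) * \<bar>t / inv_sd a\<bar> \<le> 1"
    by (simp only: abs_mult N_def abs_of_nat)
  have "inv_var a * (t / inv_sd a)\<^sup>2 / 2 = t\<^sup>2 / 2"
    using vpos by (simp add: power_divide sd)
  then have "\<bar>log_char a (t / inv_sd a) + t\<^sup>2 / 2\<bar> \<le> d * (y\<^sup>2 / 8)"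
    using log_char_bound[OF small assms(1)] assms(2)
    by (simp add: d_def y_def N_def of_nat_diff flip: power_mult)
  also have "\<dots> \<le> d * ((36 * t\<^sup>2 / d)\<^sup>2 / 8)"
    using d yd by (intro mult_left_mono divide_right_mono power_mono) (auto simp: y_def)
  also have "\<dots> = 162 * t ^ 4 / d"
    using d by (simp add: field_simps eval_nat_numeral)
  finally show "\<bar>log_char a (t / inv_sd a) + t\<^sup>2 / 2\<bar> \<le> 162 * t ^ 4 / (real (sum_list a) - real (Max (set a)))"
    by (simp add: d_def N_def)
qed

theorem theorem1p2:
  fixes a :: "nat \<Rightarrow> nat list"
  assumes "\<And>\<nu>. \<nu> \<ge> 1 \<Longrightarrow> length (a \<nu>) \<ge> 2"
    and "\<And>\<nu> x. \<nu> \<ge> 1 \<Longrightarrow> x \<in> set (a \<nu>) \<Longrightarrow> x \<ge> 1"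
    and "filterlim (\<lambda>\<nu>. real (sum_list (a \<nu>)) - real (Max (set (a \<nu>)))) at_top sequentially"
  shows "weak_conv_m
           (\<lambda>\<nu>. distr (measure_pmf (random_word (a \<nu>))) borel
                   (\<lambda>w. (real (inversions w) - inv_mean (a \<nu>)) / inv_sd (a \<nu>)))
           std_normal_distribution"
proof (rule levy_continuity)
  show "real_distribution (distr (measure_pmf (random_word (a \<nu>))) borel
          (\<lambda>w. (real (inversions w) - inv_mean (a \<nu>)) / inv_sd (a \<nu>)))" for \<nu>
    by (intro prob_space.real_distribution_distr prob_space_measure_pmf) simp
  show "real_distribution std_normal_distribution"
    by (rule real_dist_normal_dist)
  fix t :: real
  let ?d = "\<lambda>\<nu>. real (sum_list (a \<nu>)) - real (Max (set (a \<nu>)))"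
  let ?L = "\<lambda>\<nu>. log_char (a \<nu>) (t / inv_sd (a \<nu>))"
  have ev: "\<forall>\<^sub>F \<nu> in sequentially. a \<nu> \<noteq> [] \<and> ?d \<nu> > 0 \<and> 36 * t\<^sup>2 \<le> ?d \<nu>"
  proof -
    have "\<forall>\<^sub>F \<nu> in sequentially. a \<nu> \<noteq> []"
      \<comment> \<open>The length condition is assumed from index 1 on, so \<open>a 0\<close> may
        be empty.\<close>
      using eventually_ge_at_top[of 1] by eventually_elim (use assms(1) in fastforce)
    moreover have "\<forall>\<^sub>F \<nu> in sequentially. ?d \<nu> > 0"
      using assms(3) unfolding filterlim_at_top_dense by blast
    moreover have "\<forall>\<^sub>F \<nu> in sequentially. ?d \<nu> \<ge> 36 * t\<^sup>2"
      using assms(3) unfolding filterlim_at_top by blast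
    ultimately show ?thesis
      by eventually_elim blast
  qed
  have "(\<lambda>\<nu>. 162 * t ^ 4 / ?d \<nu>) \<longlonglongrightarrow> 0"
    using assms(3) by (intro tendsto_divide_0[OF tendsto_const] filterlim_at_top_imp_at_infinity)
  moreover have "\<forall>\<^sub>F \<nu> in sequentially. norm (?L \<nu> - (- t\<^sup>2 / 2)) \<le> 162 * t ^ 4 / ?d \<nu>"
    using ev
  proof eventually_elim
    case (elim \<nu>)
    then show ?case
      using log_char_standardized(2)[of "a \<nu>" t] by (simp del: of_nat_less_iff)
  qed
  ultimately have "(\<lambda>\<nu>. ?L \<nu> - (- t\<^sup>2 / 2)) \<longlonglongrightarrow> 0"
    by (rule Lim_null_comparison[rotated])
  then have "?L \<longlonglongrightarrow> - t\<^sup>2 / 2"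
    by (rule LIM_zero_cancel)
  then have "(\<lambda>\<nu>. complex_of_real (exp (?L \<nu>))) \<longlonglongrightarrow> of_real (exp (- t\<^sup>2 / 2))"
    by (rule tendsto_of_real[OF tendsto_exp])
  \<comment> \<open>The closed form of the characteristic function holds for small arguments, hence
    at a fixed \<open>t\<close> for all large indices.\<close>
  moreover have "\<forall>\<^sub>F \<nu> in sequentially. complex_of_real (exp (?L \<nu>)) =
      char (distr (measure_pmf (random_word (a \<nu>))) borel
        (\<lambda>w. (real (inversions w) - inv_mean (a \<nu>)) / inv_sd (a \<nu>))) t"
    using ev
  proof eventually_elim
    case (elim \<nu>)
    then have "real (sum_list (a \<nu>)) * \<bar>t / inv_sd (a \<nu>)\<bar> \<le> 1"
      by (intro log_char_standardized(1)) simp_all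
    then show ?case
      by (rule char_standardized_inversions[symmetric])
  qed
  ultimately show "(\<lambda>\<nu>. char (distr (measure_pmf (random_word (a \<nu>))) borel
        (\<lambda>w. (real (inversions w) - inv_mean (a \<nu>)) / inv_sd (a \<nu>))) t)
      \<longlonglongrightarrow> char std_normal_distribution t"
    unfolding char_std_normal_distribution by (rule Lim_transform_eventually)
qed

end
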